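(* Let $T$ be an integral domain. Then $R(T)$ is a local ring, and its maximal ideal is generated by all elements of the form $\frac{1}{x}$, where $0\neq x\in T$ is not an Egyptian element of $T$.
   Context: For an integral domain $T$ with fraction field $F(T)$, the reciprocal complement $R(T)$ is the subring of $F(T)$ generated by all $1/f$ with $f\in T\setminus\{0\}$; equivalently, $R(T)$ is the set of all finite sums $\frac1{f_1}+\cdots+\frac1{f_t}$ with $t\ge 0$ and each $f_i\in T\setminus\{0\}$. A nonzero element of $F(T)$ is called ($T$-)Egyptian if it can be written as a finite sum of reciprocals of nonzero elements of $T$ (i.e. it lies in $R(T)$); an Egyptian element of $T$ is a nonzero element of $T$ that is $T$-Egyptian. "Local" means having a unique maximal ideal (no Noetherian hypothesis). *)

theory Defs
  imports
    "HOL-Algebra.Generated_Rings"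
    "HOL-Algebra.Algebraic_Closure_Type"
    "HOL-Computational_Algebra.Polynomial_Factorial"
begin

text \<open>
  An integral domain \<open>T\<close> is a type \<open>'a\<close> of class \<^class>\<open>idom\<close>, and its fraction field \<open>F(T)\<close>
  is \<open>'a fract\<close>. Since \<open>R(T)\<close> is a subset of \<open>'a fract\<close> and not a type, it is made into an
  explicit ring with carrier, to which the notions of ideal and maximal ideal apply.
\<close>

definition reciprocals :: "'a::idom fract set" where
  "reciprocals = {1 / to_fract f | f. f \<noteq> 0}"

definition recip_complement :: "'a::idom fract ring" where
  "recip_complement =
     ring_of_type_algebra\<lparr>carrier := generate_ring ring_of_type_algebra reciprocals\<rparr>"

definition egyptian :: "'a::idom fract \<Rightarrow> bool" where
  "egyptian y \<longleftrightarrow> y \<noteq> 0 \<and> (\<exists>fs. 0 \<notin> set fs \<and> y = (\<Sum>f\<leftarrow>fs. 1 / to_fract f))"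

text \<open>No Noetherian hypothesis.\<close>

definition local_ring :: "('a, 'b) ring_scheme \<Rightarrow> bool" where
  "local_ring R \<longleftrightarrow> cring R \<and> (\<exists>!M. maximalideal M R)"

lemma recip_complement_simps [simp]:
  "x \<otimes>\<^bsub>recip_complement\<^esub> y = x * y" "\<one>\<^bsub>recip_complement\<^esub> = 1"
  "\<zero>\<^bsub>recip_complement\<^esub> = 0" "x \<oplus>\<^bsub>recip_complement\<^esub> y = x + y"
  by (simp_all add: recip_complement_def ring_of_type_algebra_def)

text \<open>The two descriptions of \<open>R(T)\<close> agree: generated subring, and finite sums of reciprocals.\<close>

lemma sum_recip_mult:
  fixes fs gs :: "'a::idom list"
  assumes "0 \<notin> set fs" "0 \<notin> set gs"
  shows "\<exists>hs. 0 \<notin> set hs \<and>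
    (\<Sum>f\<leftarrow>fs. 1 / to_fract f) * (\<Sum>g\<leftarrow>gs. 1 / to_fract g) = (\<Sum>h\<leftarrow>hs. 1 / to_fract h)"
  using assms(1)
proof (induction fs)
  case Nil
  show ?case by (rule exI[of _ "[]"]) simp
next
  case (Cons a fs)
  then obtain hs where hs: "0 \<notin> set hs"
    "(\<Sum>f\<leftarrow>fs. 1 / to_fract f) * (\<Sum>g\<leftarrow>gs. 1 / to_fract g) = (\<Sum>h\<leftarrow>hs. 1 / to_fract h)"
    by auto
  have "(1 / to_fract a) * (\<Sum>g\<leftarrow>gs. 1 / to_fract g) = (\<Sum>h\<leftarrow>map ((*) a) gs. 1 / to_fract h)"
    by (induction gs) (simp_all add: algebra_simps)
  with hs Cons.prems assms(2) show ?case
    by (intro exI[of _ "map ((*) a) gs @ hs"]) (auto simp: distrib_right)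
qed

lemma a_inv_ring_of_type_algebra:
  "a_inv (ring_of_type_algebra :: 'b::comm_ring_1 ring) x = - x"
proof -
  interpret T: cring "ring_of_type_algebra :: 'b ring" by (rule cring_from_type_algebra)
  show ?thesis
    by (rule sym, rule T.sum_zero_eq_neg) (simp_all add: ring_of_type_algebra_def)
qed

lemma carrier_recip_complement:
  "carrier (recip_complement :: 'a::idom fract ring) =
     {\<Sum>f\<leftarrow>fs. 1 / to_fract f | fs. 0 \<notin> set fs}"
proof (intro equalityI subsetI)
  fix y :: "'a fract"
  assume "y \<in> carrier recip_complement"
  then have "y \<in> generate_ring ring_of_type_algebra reciprocals"
    by (simp add: recip_complement_def)
  then have "\<exists>fs. 0 \<notin> set fs \<and> y = (\<Sum>f\<leftarrow>fs. 1 / to_fract f)"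
  proof induction
    case one
    show ?case by (rule exI[of _ "[1]"]) (simp add: ring_of_type_algebra_def)
  next
    case (incl h)
    then obtain f where "f \<noteq> 0" "h = 1 / to_fract f" by (auto simp: reciprocals_def)
    then show ?case by (intro exI[of _ "[f]"]) simp
  next
    case (a_inv h)
    then obtain fs where "0 \<notin> set fs" "h = (\<Sum>f\<leftarrow>fs. 1 / to_fract f)" by blast
    moreover have "(\<Sum>f\<leftarrow>map uminus fs. 1 / to_fract f) = - (\<Sum>f\<leftarrow>fs. 1 / to_fract f)"
      by (induction fs) simp_all
    ultimately show ?case
      by (intro exI[of _ "map uminus fs"]) (auto simp: a_inv_ring_of_type_algebra)
  next
    case (eng_add h1 h2)
    then obtain fs gs where "0 \<notin> set fs" "h1 = (\<Sum>f\<leftarrow>fs. 1 / to_fract f)"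
      "0 \<notin> set gs" "h2 = (\<Sum>f\<leftarrow>gs. 1 / to_fract f)" by blast
    then show ?case by (intro exI[of _ "fs @ gs"]) (simp add: ring_of_type_algebra_def)
  next
    case (eng_mult h1 h2)
    then show ?case using sum_recip_mult by (fastforce simp: ring_of_type_algebra_def)
  qed
  then show "y \<in> {\<Sum>f\<leftarrow>fs. 1 / to_fract f | fs. 0 \<notin> set fs}" by blast
next
  fix y :: "'a fract"
  assume "y \<in> {\<Sum>f\<leftarrow>fs. 1 / to_fract f | fs. 0 \<notin> set fs}"
  then obtain fs where fs: "0 \<notin> set fs" and y: "y = (\<Sum>f\<leftarrow>fs. 1 / to_fract f)" by blast
  interpret F: cring "ring_of_type_algebra :: 'a fract ring" by (rule cring_from_type_algebra)
  have "(\<Sum>f\<leftarrow>fs. 1 / to_fract f) \<in> generate_ring ring_of_type_algebra reciprocals"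
    using fs
  proof (induction fs)
    case Nil
    then show ?case
      using F.zero_in_generate[of reciprocals] by (simp add: ring_of_type_algebra_def)
  next
    case (Cons a fs)
    then have "1 / to_fract a \<in> generate_ring ring_of_type_algebra reciprocals"
      by (intro generate_ring.incl) (auto simp: reciprocals_def)
    from generate_ring.eng_add[OF this Cons.IH] Cons.prems show ?case
      by (simp add: ring_of_type_algebra_def)
  qed
  then show "y \<in> carrier recip_complement" by (simp add: y recip_complement_def)
qed

lemma egyptian_iff: "egyptian y \<longleftrightarrow> y \<noteq> 0 \<and> y \<in> carrier recip_complement"
  by (auto simp: egyptian_def carrier_recip_complement)

end

theory Submission
  imports Defs
begin

text \<open>
  An element \<open>x \<noteq> 0\<close> of \<open>T\<close> is non-Egyptian iff \<open>1/x\<close> is not a unit of \<open>R(T)\<close>. Let \<open>M\<close> be the set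
  of all finite sums of reciprocals of non-Egyptian elements. If \<open>x\<close> is non-Egyptian then so is
  every nonzero multiple of it, so \<open>M\<close> is an ideal, and it is the ideal generated by those
  reciprocals. It remains to see that every element of \<open>R(T)\<close> outside \<open>M\<close> is a unit and that
  \<open>1\<close> is not in \<open>M\<close>.

  Both facts rest on one observation. Put a sum over a common denominator,
  \<open>\<alpha> = 1/f\<^sub>1 + \<dots> + 1/f\<^sub>n = p/(f\<^sub>1\<dots>f\<^sub>n)\<close> with \<open>p\<close> in \<open>T\<close>. If \<open>\<alpha> \<noteq> 0\<close>, then \<open>1/p\<close> is in
  \<open>R(T)\<close>, hence \<open>\<alpha>\<close> divides \<open>(1/f\<^sub>1)\<dots>(1/f\<^sub>n)\<close> in \<open>R(T)\<close>.

  If all \<open>f\<^sub>i\<close> are Egyptian, this product is a unit, so such a sum is \<open>0\<close> or a unit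
  (\<open>sum_recip_egyptian_unit\<close>). If \<open>\<alpha> = 1 + 1/g\<^sub>1 + \<dots> + 1/g\<^sub>n\<close> with all \<open>g\<^sub>i\<close> non-Egyptian, then
  \<open>\<alpha>\<close> is always a unit (\<open>one_plus_nonegyptian_unit\<close>). By induction on \<open>n\<close>, dropping any one
  summand \<open>1/g\<^sub>i\<close> leaves a unit, so modulo \<open>\<alpha>\<close> every \<open>1/g\<^sub>i\<close> is minus a unit and so is invertible;
  but the product of the \<open>1/g\<^sub>i\<close> is \<open>0\<close> modulo \<open>\<alpha>\<close>, so \<open>\<alpha>\<close> is a unit unless \<open>\<alpha> = 0\<close>, and in that
  case \<open>1/g\<^sub>1\<close> itself would be minus a unit. Consequently \<open>-1\<close>, and with it \<open>1\<close>,
  is not in \<open>M\<close>. Finally an arbitrary element of \<open>R(T)\<close> is \<open>u + m\<close> with \<open>m\<close> in \<open>M\<close> and \<open>u\<close> a sum of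
  reciprocals of Egyptian elements; when \<open>u\<close> is a unit, so is \<open>u (1 + m/u)\<close>.
\<close>

section \<open>Arithmetic in the reciprocal complement\<close>

abbreviation recip_sum :: "'a::idom list \<Rightarrow> 'a fract" where
  "recip_sum fs \<equiv> (\<Sum>f\<leftarrow>fs. 1 / to_fract f)"

abbreviation RC :: "'a::idom fract set" where
  "RC \<equiv> carrier recip_complement"

lemma recip_complement_cring: "cring (recip_complement :: 'a::idom fract ring)"
proof -
  interpret F: cring "ring_of_type_algebra :: 'a fract ring" by (rule cring_from_type_algebra)
  have sr: "subring (generate_ring ring_of_type_algebra reciprocals)
              (ring_of_type_algebra :: 'a fract ring)"
    by (rule F.generate_ring_is_subring) (simp add: ring_of_type_algebra_def)
  have "subcring (generate_ring ring_of_type_algebra reciprocals)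
              (ring_of_type_algebra :: 'a fract ring)"
    by (rule F.subcringI'[OF sr])
  then show ?thesis
    unfolding recip_complement_def by (rule F.subcring_iff[THEN iffD1, rotated])
      (simp add: ring_of_type_algebra_def)
qed

lemma recip_sum_mem: "0 \<notin> set fs \<Longrightarrow> recip_sum fs \<in> RC"
  unfolding carrier_recip_complement by blast

lemma recip_mem: "f \<noteq> 0 \<Longrightarrow> 1 / to_fract f \<in> RC"
  using recip_sum_mem[of "[f]"] by simp

lemma RC_zero: "0 \<in> RC" and RC_one: "1 \<in> RC"
  using recip_sum_mem[of "[]"] recip_mem[of 1] by simp_all

lemma RC_add: "a \<in> RC \<Longrightarrow> b \<in> RC \<Longrightarrow> a + b \<in> RC"
  using cring.cring_simprules(1)[OF recip_complement_cring] by simp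

lemma RC_mult: "a \<in> RC \<Longrightarrow> b \<in> RC \<Longrightarrow> a * b \<in> RC"
  using cring.cring_simprules(5)[OF recip_complement_cring] by simp

lemma RC_uminus: "a \<in> RC \<Longrightarrow> - a \<in> RC"
  using RC_mult[OF recip_mem[of "-1"], of a] by simp

lemma RC_diff: "a \<in> RC \<Longrightarrow> b \<in> RC \<Longrightarrow> a - b \<in> RC"
  using RC_add[OF _ RC_uminus, of a b] by simp

definition recip_unit :: "'a::idom fract \<Rightarrow> bool" where
  "recip_unit u \<longleftrightarrow> u \<in> RC \<and> u \<noteq> 0 \<and> 1 / u \<in> RC"

lemma recip_unit_mult: "recip_unit u \<Longrightarrow> recip_unit v \<Longrightarrow> recip_unit (u * v)"
  using RC_mult[of u v] RC_mult[of "1 / u" "1 / v"] by (simp add: recip_unit_def)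

lemma recip_unit_uminus: "recip_unit u \<Longrightarrow> recip_unit (- u)"
  using RC_uminus[of u] RC_uminus[of "1 / u"] by (simp add: recip_unit_def)

lemma recip_unit_one: "recip_unit 1"
  by (simp add: recip_unit_def RC_one)

lemma recip_unit_imp_Units: "recip_unit u \<Longrightarrow> u \<in> Units recip_complement"
  unfolding Units_def recip_unit_def by (auto intro!: bexI[of _ "1 / u"])

lemma recip_sum_common_denominator:
  assumes "0 \<notin> set fs"
  shows "\<exists>p. recip_sum fs = to_fract p / to_fract (prod_list fs)"
  using assms
proof (induction fs)
  case Nil
  show ?case by (rule exI[of _ 0]) simp
next
  case (Cons a fs)
  then obtain p where p: "recip_sum fs = to_fract p / to_fract (prod_list fs)" by auto
  from Cons.prems have "a \<noteq> 0" "prod_list fs \<noteq> 0" by (auto simp: prod_list_zero_iff)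
  then show ?case
    by (intro exI[of _ "prod_list fs + a * p"]) (simp add: p field_simps)
qed

lemma recip_prod_eq: "(\<Prod>f\<leftarrow>fs. 1 / to_fract f) = 1 / to_fract (prod_list fs)"
  by (induction fs) simp_all

text \<open>
  A nonzero sum of reciprocals divides, inside the reciprocal complement, the product of these
  reciprocals: the quotient is the reciprocal of the numerator over the common denominator.
\<close>

lemma recip_sum_dvd_recip_prod:
  assumes "0 \<notin> set fs" "recip_sum fs \<noteq> 0"
  obtains d where "d \<in> RC" "(\<Prod>f\<leftarrow>fs. 1 / to_fract f) = recip_sum fs * d"
proof -
  obtain p where p: "recip_sum fs = to_fract p / to_fract (prod_list fs)"
    using recip_sum_common_denominator[OF assms(1)] by blast
  with assms(2) have "p \<noteq> 0" by auto
  then have "(\<Prod>f\<leftarrow>fs. 1 / to_fract f) = recip_sum fs * (1 / to_fract p)"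
    unfolding recip_prod_eq p by simp
  with recip_mem[OF \<open>p \<noteq> 0\<close>] show ?thesis by (rule that)
qed

lemma recip_unit_dvd:
  assumes "recip_unit (a * b)" "a \<in> RC" "b \<in> RC"
  shows "recip_unit a"
proof -
  have "1 / a = b * (1 / (a * b))" using assms(1) by (simp add: recip_unit_def)
  with assms show ?thesis using RC_mult[of b "1 / (a * b)"] by (simp add: recip_unit_def)
qed

section \<open>Egyptian and non-Egyptian denominators\<close>

abbreviation nonegyptian :: "'a::idom \<Rightarrow> bool" where
  "nonegyptian x \<equiv> x \<noteq> 0 \<and> \<not> egyptian (to_fract x)"

lemma recip_unit_recip_iff: "x \<noteq> 0 \<Longrightarrow> recip_unit (1 / to_fract x) \<longleftrightarrow> egyptian (to_fract x)"
  by (simp add: recip_unit_def egyptian_iff recip_mem)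

text \<open>If \<open>x y\<close> is Egyptian, then so is \<open>x = (1/y) (x y)\<close>.\<close>

lemma nonegyptian_mult: "nonegyptian x \<Longrightarrow> y \<noteq> 0 \<Longrightarrow> nonegyptian (x * y)"
  using RC_mult[OF recip_mem[of y], of "to_fract (x * y)"] by (auto simp: egyptian_iff)

text \<open>A divisor of a unit is a unit, and the product of the \<open>1/f\<close> is one.\<close>

lemma sum_recip_egyptian_unit:
  assumes "\<forall>f\<in>set fs. egyptian (to_fract f)" "recip_sum fs \<noteq> 0"
  shows "recip_unit (recip_sum fs)"
proof -
  have fs: "0 \<notin> set fs" using assms(1) by (auto simp: egyptian_def)
  then obtain d where d: "d \<in> RC" "(\<Prod>f\<leftarrow>fs. 1 / to_fract f) = recip_sum fs * d"
    using recip_sum_dvd_recip_prod assms(2) by blast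
  have "recip_unit (\<Prod>f\<leftarrow>fs. 1 / to_fract f)"
    using assms(1)
  proof (induction fs)
    case (Cons f fs)
    then have "recip_unit (1 / to_fract f)"
      by (subst recip_unit_recip_iff) (auto simp: egyptian_def)
    from recip_unit_mult[OF this] Cons show ?case by simp
  qed (simp add: recip_unit_one)
  then show ?thesis using recip_unit_dvd d recip_sum_mem[OF fs] by metis
qed

text \<open>Invertibility modulo \<open>\<alpha>\<close> passes to products; it is witnessed by units of the ring itself.\<close>

lemma prod_list_unit_mod:
  assumes "\<alpha> \<in> RC" "\<forall>x\<in>set xs. recip_unit (\<alpha> - x)"
  shows "\<exists>c\<in>RC. recip_unit (prod_list xs - \<alpha> * c)"
  using assms(2)
proof (induction xs)
  case Nil
  show ?case by (rule bexI[of _ 0]) (simp_all add: recip_unit_one RC_zero)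
next
  case (Cons x xs)
  then obtain c where c: "c \<in> RC" "recip_unit (prod_list xs - \<alpha> * c)" by auto
  define \<beta> u where "\<beta> = \<alpha> - x" and "u = prod_list xs - \<alpha> * c"
  have \<beta>: "recip_unit \<beta>" and u: "recip_unit u"
    using Cons.prems c by (simp_all add: \<beta>_def u_def)
  have "x * prod_list xs - \<alpha> * (\<alpha> * c - \<beta> * c + u) = - (\<beta> * u)"
    by (simp add: \<beta>_def u_def algebra_simps)
  moreover have "recip_unit (- (\<beta> * u))"
    using \<beta> u by (intro recip_unit_uminus recip_unit_mult)
  moreover have "\<alpha> * c - \<beta> * c + u \<in> RC"
    using assms(1) c(1) \<beta> u by (intro RC_add RC_diff RC_mult) (simp_all add: recip_unit_def)
  ultimately show ?case by (intro bexI[of _ "\<alpha> * c - \<beta> * c + u"]) simp_all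
qed

text \<open>
  The heart of the proof, by induction on the number of summands. Write \<open>\<alpha>\<close> for the sum. Each
  \<open>\<alpha> - 1/g\<close> is a unit by induction, so \<open>\<alpha> \<noteq> 0\<close> since \<open>1/g\<close> is not a unit. Moreover the product
  of the \<open>1/g\<close> is a unit modulo \<open>\<alpha>\<close>; as \<open>\<alpha>\<close> divides this product, \<open>\<alpha>\<close> divides a unit.
\<close>

lemma one_plus_nonegyptian_unit:
  assumes "\<forall>g\<in>set gs. nonegyptian g"
  shows "recip_unit (1 + recip_sum gs)"
  using assms
proof (induction gs rule: length_induct)
  case (1 gs)
  define \<alpha> where "\<alpha> = 1 + recip_sum gs"
  have gs: "0 \<notin> set gs" using 1 by auto
  then have \<alpha>: "\<alpha> \<in> RC" unfolding \<alpha>_def by (intro RC_add RC_one recip_sum_mem)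
  have drop_unit: "recip_unit (\<alpha> - 1 / to_fract g)" if g: "g \<in> set gs" for g
  proof -
    have "length (remove1 g gs) < length gs"
      using g by (metis One_nat_def Suc_pred length_pos_if_in_set length_remove1 lessI)
    moreover have "\<forall>h\<in>set (remove1 g gs). nonegyptian h"
      using 1(2) set_remove1_subset by fast
    ultimately have "recip_unit (1 + recip_sum (remove1 g gs))" using 1(1) by blast
    moreover have "\<alpha> - 1 / to_fract g = 1 + recip_sum (remove1 g gs)"
      unfolding \<alpha>_def sum_list_map_remove1[OF g] by simp
    ultimately show ?thesis by simp
  qed
  have "\<alpha> \<noteq> 0"
  proof
    assume 0: "\<alpha> = 0"
    then have "gs \<noteq> []" by (auto simp: \<alpha>_def)
    then have g: "hd gs \<in> set gs" by simp
    have "recip_unit (1 / to_fract (hd gs))"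
      using recip_unit_uminus[OF drop_unit[OF g]] 0 by simp
    then show False using 1(2) g recip_unit_recip_iff by blast
  qed
  moreover have \<alpha>_eq: "\<alpha> = recip_sum (1 # gs)" by (simp add: \<alpha>_def)
  ultimately obtain d where d: "d \<in> RC" "(\<Prod>f\<leftarrow>1 # gs. 1 / to_fract f) = \<alpha> * d"
    using recip_sum_dvd_recip_prod[of "1 # gs"] gs by auto
  obtain c where c: "c \<in> RC" "recip_unit ((\<Prod>g\<leftarrow>gs. 1 / to_fract g) - \<alpha> * c)"
    using prod_list_unit_mod[OF \<alpha>, of "map (\<lambda>g. 1 / to_fract g) gs"] drop_unit by auto
  have "recip_unit (\<alpha> * (d - c))" using c(2) d(2) by (simp add: right_diff_distrib)
  then show "recip_unit (1 + recip_sum gs)"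
    using recip_unit_dvd[of \<alpha> "d - c"] \<alpha> RC_diff[OF d(1) c(1)] by (simp add: \<alpha>_def)
qed

section \<open>The ideal of non-Egyptian sums\<close>

definition nonegyptian_sums :: "'a::idom fract set" where
  "nonegyptian_sums = {recip_sum gs | gs. \<forall>g\<in>set gs. nonegyptian g}"

lemma nonegyptian_sums_subset: "nonegyptian_sums \<subseteq> RC"
  unfolding nonegyptian_sums_def using recip_sum_mem by blast

lemma nonegyptian_sums_zero: "0 \<in> nonegyptian_sums"
  unfolding nonegyptian_sums_def by (auto intro!: exI[of _ "[]"])

lemma nonegyptian_sums_recip: "nonegyptian x \<Longrightarrow> 1 / to_fract x \<in> nonegyptian_sums"
  unfolding nonegyptian_sums_def by (auto intro!: exI[of _ "[x]"])

lemma nonegyptian_sums_add: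
  assumes "a \<in> nonegyptian_sums" "b \<in> nonegyptian_sums"
  shows "a + b \<in> nonegyptian_sums"
proof -
  obtain gs hs where "\<forall>g\<in>set gs. nonegyptian g" "\<forall>h\<in>set hs. nonegyptian h"
    and "a = recip_sum gs" "b = recip_sum hs"
    using assms unfolding nonegyptian_sums_def by blast
  then show ?thesis unfolding nonegyptian_sums_def by (auto intro!: exI[of _ "gs @ hs"])
qed

lemma nonegyptian_sums_absorb:
  assumes a: "a \<in> nonegyptian_sums" and r: "r \<in> RC"
  shows "r * a \<in> nonegyptian_sums"
proof -
  obtain fs where fs: "0 \<notin> set fs" and r_eq: "r = recip_sum fs"
    using r unfolding carrier_recip_complement by blast
  have recip: "1 / to_fract f * a \<in> nonegyptian_sums" if f: "f \<noteq> 0" for f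
  proof -
    obtain gs where gs: "\<forall>g\<in>set gs. nonegyptian g" "a = recip_sum gs"
      using a unfolding nonegyptian_sums_def by blast
    have "1 / to_fract f * recip_sum gs = recip_sum (map (\<lambda>g. g * f) gs)"
      by (induction gs) (simp_all add: algebra_simps)
    moreover have "\<forall>h\<in>set (map (\<lambda>g. g * f) gs). nonegyptian h"
      using gs(1) f nonegyptian_mult by fastforce
    ultimately show ?thesis unfolding nonegyptian_sums_def gs(2) by blast
  qed
  show ?thesis using fs unfolding r_eq
  proof (induction fs)
    case Nil
    show ?case by (simp add: nonegyptian_sums_zero)
  next
    case (Cons f fs)
    then show ?case
      using nonegyptian_sums_add[OF recip[of f], of "recip_sum fs * a"]
      by (simp add: distrib_right)
  qed
qed

lemma ideal_nonegyptian_sums: "ideal nonegyptian_sums recip_complement"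
proof -
  interpret R: cring "recip_complement :: 'a fract ring" by (rule recip_complement_cring)
  have minus: "\<ominus>\<^bsub>recip_complement\<^esub> a = - a" if "a \<in> RC" for a :: "'a fract"
    by (rule sym, rule R.sum_zero_eq_neg) (use that RC_uminus in auto)
  show ?thesis
  proof (rule idealI)
    show "subgroup nonegyptian_sums (add_monoid (recip_complement :: 'a fract ring))"
    proof (rule group.subgroupI)
      show "group (add_monoid (recip_complement :: 'a fract ring))" by (rule R.add.is_group)
      fix a :: "'a fract"
      assume a: "a \<in> nonegyptian_sums"
      then have "- 1 * a \<in> nonegyptian_sums"
        by (intro nonegyptian_sums_absorb RC_uminus RC_one)
      then show "inv\<^bsub>add_monoid recip_complement\<^esub> a \<in> nonegyptian_sums"
        using minus[of a] a nonegyptian_sums_subset by (auto simp: a_inv_def)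
    qed (use nonegyptian_sums_subset nonegyptian_sums_zero nonegyptian_sums_add in auto)
  qed (use nonegyptian_sums_absorb in \<open>auto simp: R.ring_axioms mult.commute\<close>)
qed

lemma genideal_nonegyptian:
  "genideal recip_complement {1 / to_fract x | x :: 'a::idom. nonegyptian x} = nonegyptian_sums"
  (is "genideal _ ?S = _")
proof
  interpret R: cring "recip_complement :: 'a fract ring" by (rule recip_complement_cring)
  show "genideal recip_complement ?S \<subseteq> nonegyptian_sums"
    using nonegyptian_sums_recip by (intro R.genideal_minimal ideal_nonegyptian_sums) blast
  have S: "?S \<subseteq> RC" using recip_mem by blast
  interpret I: ideal "genideal recip_complement ?S" recip_complement
    by (rule R.genideal_ideal[OF S])
  show "nonegyptian_sums \<subseteq> genideal recip_complement ?S"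
  proof
    fix m :: "'a fract"
    assume "m \<in> nonegyptian_sums"
    then obtain gs where gs: "\<forall>g\<in>set gs. nonegyptian g" and m: "m = recip_sum gs"
      unfolding nonegyptian_sums_def by blast
    from gs show "m \<in> genideal recip_complement ?S" unfolding m
    proof (induction gs)
      case Nil
      show ?case using I.zero_closed by simp
    next
      case (Cons g gs)
      then have "1 / to_fract g \<in> genideal recip_complement ?S"
        using R.genideal_self[OF S] by auto
      then show ?case using I.a_closed Cons by fastforce
    qed
  qed
qed

lemma one_notin_nonegyptian_sums: "1 \<notin> (nonegyptian_sums :: 'a::idom fract set)"
proof
  assume "1 \<in> (nonegyptian_sums :: 'a fract set)"
  then have "- 1 * 1 \<in> (nonegyptian_sums :: 'a fract set)"
    using RC_uminus[OF RC_one] by (rule nonegyptian_sums_absorb)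
  then obtain gs :: "'a list"
    where "\<forall>g\<in>set gs. nonegyptian g" and m: "- 1 = recip_sum gs"
    unfolding nonegyptian_sums_def by auto
  then have "recip_unit (1 + recip_sum gs)" by (intro one_plus_nonegyptian_unit)
  then show False by (simp add: m[symmetric] recip_unit_def)
qed

text \<open>
  Sort the summands of \<open>r\<close> into those with Egyptian and those with non-Egyptian denominator. The
  Egyptian part is not \<open>0\<close>, hence a unit \<open>u\<close>, and \<open>r = u (1 + m/u)\<close> with \<open>m/u\<close> in the ideal.
\<close>

lemma unit_if_notin_nonegyptian_sums:
  assumes r: "r \<in> RC" "r \<notin> nonegyptian_sums"
  shows "recip_unit r"
proof -
  obtain fs where fs: "0 \<notin> set fs" and r_eq: "r = recip_sum fs"
    using r(1) unfolding carrier_recip_complement by blast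
  define u where "u = recip_sum (filter (\<lambda>f. egyptian (to_fract f)) fs)"
  define m where "m = recip_sum (filter (\<lambda>f. \<not> egyptian (to_fract f)) fs)"
  have "r = u + m" unfolding r_eq u_def m_def by (induction fs) simp_all
  have m: "m \<in> nonegyptian_sums"
    unfolding m_def nonegyptian_sums_def using fs by fastforce
  with r(2) \<open>r = u + m\<close> have "u \<noteq> 0" by auto
  then have u: "recip_unit u" unfolding u_def by (intro sum_recip_egyptian_unit) auto
  have "1 / u * m \<in> nonegyptian_sums"
    using m u by (intro nonegyptian_sums_absorb) (simp_all add: recip_unit_def)
  then have "recip_unit (1 + 1 / u * m)"
    unfolding nonegyptian_sums_def using one_plus_nonegyptian_unit by fastforce
  from recip_unit_mult[OF u this] show ?thesis
    using \<open>u \<noteq> 0\<close> \<open>r = u + m\<close> by (simp add: distrib_left)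
qed

section \<open>Locality from units\<close>

text \<open>A proper ideal contains no unit, so every proper ideal lies in \<open>M\<close>.\<close>

lemma (in cring) local_if_complement_units:
  assumes M: "ideal M R" "\<one> \<notin> M" and units: "carrier R - M \<subseteq> Units R"
  shows "local_ring R \<and> maximalideal M R"
proof -
  have proper: "J \<subseteq> M" if J: "ideal J R" "J \<noteq> carrier R" for J
  proof
    fix x assume x: "x \<in> J"
    interpret J: ideal J R by (rule J(1))
    show "x \<in> M"
    proof (rule ccontr)
      assume "x \<notin> M"
      then have "x \<in> Units R" using units x J.a_subset by blast
      then have "\<one> \<in> J" using J.I_l_closed[OF x, of "inv x"] by simp
      then show False using J.one_imp_carrier J(2) by blast
    qed
  qed
  have max: "maximalideal M R"
    using M proper by (intro maximalidealI) auto
  moreover have "N = M" if "maximalideal N R" for N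
  proof -
    interpret N: maximalideal N R by (rule that)
    have "N \<subseteq> M" using proper[OF N.is_ideal] N.I_notcarr by blast
    then show ?thesis
      using N.I_maximal[OF M(1)] M(2) ideal.Icarr[OF M(1)] one_closed by blast
  qed
  ultimately show ?thesis unfolding local_ring_def using is_cring by blast
qed

theorem theorem2p4:
  shows "local_ring (recip_complement :: 'a::idom fract ring) \<and>
    maximalideal
      (genideal recip_complement
        {1 / to_fract x | x :: 'a. x \<noteq> 0 \<and> \<not> egyptian (to_fract x)})
      (recip_complement :: 'a fract ring)"
  unfolding genideal_nonegyptian
proof (rule cring.local_if_complement_units[OF recip_complement_cring ideal_nonegyptian_sums])
  show "\<one>\<^bsub>recip_complement\<^esub> \<notin> (nonegyptian_sums :: 'a fract set)"
    using one_notin_nonegyptian_sums by simp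
  show "RC - nonegyptian_sums \<subseteq> Units (recip_complement :: 'a fract ring)"
    using unit_if_notin_nonegyptian_sums recip_unit_imp_Units by blast
qed

end
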